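(* Let $n \in \{0,1,\dots,N-1\}$, and let $\tau_{n+1}$ be a stopping time in $\mathcal{T}_{n+1}$ of the form $$\tau_{n+1} = \sum_{m=n+1}^{N} m f_m(X_m) \prod_{j=n+1}^{m-1} (1-f_j(X_j))$$ for measurable functions $f_{n+1}, \dots, f_N \colon \mathbb{R}^d \to \{0,1\}$ with $f_N \equiv 1$. Then there exists a measurable function $f_n \colon \mathbb{R}^d \to \{0,1\}$ such that the stopping time $\tau_n \in \mathcal{T}_n$ given by $$\tau_n = \sum_{m=n}^{N} m f_m(X_m) \prod_{j=n}^{m-1} (1-f_j(X_j))$$ satisfies $$\mathbb{E}\, g(\tau_n, X_{\tau_n}) \ge V_n - \left( V_{n+1} - \mathbb{E}\, g(\tau_{n+1}, X_{\tau_{n+1}}) \right).$$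
   Context: Let $N$ and $d$ be positive integers and let $X = (X_n)_{n=0}^N$ be an $\mathbb{R}^d$-valued discrete-time Markov process on a probability space $(\Omega, \mathcal{F}, \mathbb{P})$. Let $\mathcal{F}_n$ be the $\sigma$-algebra generated by $X_0, X_1, \dots, X_n$. An $X$-stopping time is a random variable $\tau \colon \Omega \to \{0,1,\dots,N\}$ such that $\{\tau = n\} \in \mathcal{F}_n$ for all $n \in \{0,1,\dots,N\}$. Let $g \colon \{0,1,\dots,N\} \times \mathbb{R}^d \to \mathbb{R}$ be a measurable function satisfying $\mathbb{E}\,|g(n,X_n)| < \infty$ for all $n \in \{0,1,\dots,N\}$. For $n \in \{0,1,\dots,N\}$, let $\mathcal{T}_n$ be the set of all $X$-stopping times $\tau$ satisfying $n \le \tau \le N$, and let $V_n = \sup_{\tau \in \mathcal{T}_n} \mathbb{E}\, g(\tau, X_\tau)$. Empty products are understood as $1$. *)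

theory Defs
  imports "HOL-Probability.Probability"
begin

text \<open>
  The \<open>\<sigma>\<close>-algebra generated by \<open>X 0, \<dots>, X n\<close> and the one generated by \<open>X n\<close> alone.
  Both are measures whose only relevant components are the space and the measurable sets.
\<close>

definition natural_filtration ::
    "'w measure \<Rightarrow> (nat \<Rightarrow> 'w \<Rightarrow> 'a::topological_space) \<Rightarrow> nat \<Rightarrow> 'w measure" where
  "natural_filtration M X n =
     sigma (space M) {X i -` B \<inter> space M | i B. i \<le> n \<and> B \<in> sets borel}"

definition present_sigma ::
    "'w measure \<Rightarrow> (nat \<Rightarrow> 'w \<Rightarrow> 'a::topological_space) \<Rightarrow> nat \<Rightarrow> 'w measure" where
  "present_sigma M X n = vimage_algebra (space M) (X n) borel"

text \<open>
  The Markov property reads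
  \<open>P(X (n+1) \<in> B | X 0, \<dots>, X n) = P(X (n+1) \<in> B | X n)\<close> almost surely, for every Borel set \<open>B\<close>.
  The process need not be time-homogeneous, and no transition kernels are assumed.
  Only the indices \<open>0, \<dots>, N\<close> of \<open>X\<close> matter.
\<close>

locale discrete_markov_process = prob_space M
  for M :: "'w measure" and N :: nat and X :: "nat \<Rightarrow> 'w \<Rightarrow> 'a::topological_space" +
  assumes horizon_pos: "0 < N"
    and random_variable_X: "\<And>n. n \<le> N \<Longrightarrow> X n \<in> M \<rightarrow>\<^sub>M borel"
    and markov_property: "\<And>n B. n < N \<Longrightarrow> B \<in> sets borel \<Longrightarrow>
      AE \<omega> in M.
        real_cond_exp M (natural_filtration M X n) (\<lambda>\<omega>. indicator B (X (Suc n) \<omega>)) \<omega> =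
        real_cond_exp M (present_sigma M X n) (\<lambda>\<omega>. indicator B (X (Suc n) \<omega>)) \<omega>"

text \<open>
  The set of \<open>X\<close>-stopping times with values in \<open>{n..N}\<close>. A stopping time is a function on the
  sample space \<open>space M\<close>; its values elsewhere are unconstrained and never matter.
\<close>

definition stopping_times ::
    "'w measure \<Rightarrow> nat \<Rightarrow> (nat \<Rightarrow> 'w \<Rightarrow> 'a::topological_space) \<Rightarrow> nat \<Rightarrow> ('w \<Rightarrow> nat) set" where
  "stopping_times M N X n =
     {\<tau>. (\<forall>\<omega>\<in>space M. n \<le> \<tau> \<omega> \<and> \<tau> \<omega> \<le> N) \<and>
         (\<forall>k\<le>N. {\<omega> \<in> space M. \<tau> \<omega> = k} \<in> sets (natural_filtration M X k))}"

definition expected_reward ::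
    "'w measure \<Rightarrow> (nat \<Rightarrow> 'w \<Rightarrow> 'a) \<Rightarrow> (nat \<Rightarrow> 'a \<Rightarrow> real) \<Rightarrow> ('w \<Rightarrow> nat) \<Rightarrow> real" where
  "expected_reward M X g \<tau> = (\<integral>\<omega>. g (\<tau> \<omega>) (X (\<tau> \<omega>) \<omega>) \<partial>M)"

definition optimal_value ::
    "'w measure \<Rightarrow> nat \<Rightarrow> (nat \<Rightarrow> 'w \<Rightarrow> 'a::topological_space) \<Rightarrow> (nat \<Rightarrow> 'a \<Rightarrow> real) \<Rightarrow> nat \<Rightarrow> real" where
  "optimal_value M N X g n = (SUP \<tau> \<in> stopping_times M N X n. expected_reward M X g \<tau>)"

text \<open>
  The supremum is a genuine one, since it ranges over a nonempty set that is bounded above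
  as soon as the rewards \<open>g k (X k)\<close> are integrable.
\<close>

lemma stopping_times_nonempty:
  assumes "n \<le> N"
  shows "stopping_times M N X n \<noteq> {}"
proof -
  have "{\<omega> \<in> space M. n = k} \<in> sets (natural_filtration M X k)" for k
    using sets.top[of "natural_filtration M X k"]
    by (cases "n = k") (auto simp: natural_filtration_def space_measure_of_conv)
  then have "(\<lambda>_. n) \<in> stopping_times M N X n"
    using assms unfolding stopping_times_def by blast
  then show ?thesis by blast
qed

lemma bdd_above_expected_reward:
  assumes "\<And>k. k \<le> N \<Longrightarrow> integrable M (\<lambda>\<omega>. g k (X k \<omega>))"
  shows "bdd_above (expected_reward M X g ` stopping_times M N X n)"
proof (rule bdd_aboveI2)
  fix \<tau> assume "\<tau> \<in> stopping_times M N X n"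
  then have le: "\<tau> \<omega> \<le> N" if "\<omega> \<in> space M" for \<omega>
    using that by (auto simp: stopping_times_def)
  have "expected_reward M X g \<tau> \<le> (\<integral>\<omega>. norm (g (\<tau> \<omega>) (X (\<tau> \<omega>) \<omega>)) \<partial>M)"
    using integral_norm_bound[of M "\<lambda>\<omega>. g (\<tau> \<omega>) (X (\<tau> \<omega>) \<omega>)"]
    unfolding expected_reward_def real_norm_def by linarith
  also have "\<dots> \<le> (\<integral>\<omega>. (\<Sum>k\<le>N. norm (g k (X k \<omega>))) \<partial>M)"
  proof (rule integral_mono')
    show "integrable M (\<lambda>\<omega>. \<Sum>k\<le>N. norm (g k (X k \<omega>)))"
      using assms by (intro Bochner_Integration.integrable_sum integrable_norm) auto
    show "norm (g (\<tau> \<omega>) (X (\<tau> \<omega>) \<omega>)) \<le> (\<Sum>k\<le>N. norm (g k (X k \<omega>)))"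
      if "\<omega> \<in> space M" for \<omega>
      using le[OF that]
      by (intro member_le_sum[where f = "\<lambda>k. norm (g k (X k \<omega>))"]) auto
  qed (auto intro: sum_nonneg)
  finally show "expected_reward M X g \<tau> \<le> (\<integral>\<omega>. (\<Sum>k\<le>N. norm (g k (X k \<omega>))) \<partial>M)" .
qed

text \<open>
  The time composed from the decisions \<open>f n, \<dots>, f N\<close>. The truncated subtraction \<open>1 - f j x\<close> agrees
  with the usual one because decisions take values in \<open>{0, 1}\<close>.
\<close>

definition decision_time ::
    "nat \<Rightarrow> (nat \<Rightarrow> 'w \<Rightarrow> 'a) \<Rightarrow> (nat \<Rightarrow> 'a \<Rightarrow> nat) \<Rightarrow> nat \<Rightarrow> 'w \<Rightarrow> nat" where
  "decision_time N X f n \<omega> =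
     (\<Sum>m=n..N. m * f m (X m \<omega>) * (\<Prod>j=n..<m. 1 - f j (X j \<omega>)))"

end

theory Submission
  imports Defs
begin

text \<open>
  By the Markov property, the conditional expectation of the reward of \<open>\<tau>\<close> given the past up to
  time \<open>n\<close> is a function \<open>Y\<close> of \<open>X n\<close>. Stopping at time \<open>n\<close> exactly when \<open>Y \<le> g n (X n)\<close> is optimal
  among all rules that stop on some event \<open>A\<close> of the past and follow \<open>\<tau>\<close> otherwise. An arbitrary
  stopping time \<open>\<rho> \<ge> n\<close> beats such a rule, with \<open>A = {\<rho> = n}\<close>, by no more than the time that
  follows \<open>\<tau>\<close> on \<open>A\<close> and \<open>\<rho>\<close> off \<open>A\<close> beats \<open>\<tau>\<close>; the latter time lies in \<open>T (n + 1)\<close>.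
\<close>

section \<open>Generated sigma-algebras and their inclusions\<close>

lemma subalgebra_sets: "A \<in> sets F \<Longrightarrow> subalgebra M F \<Longrightarrow> A \<in> sets M"
  by (auto simp: subalgebra_def)

lemma space_natural_filtration [simp]: "space (natural_filtration M X n) = space M"
  by (simp add: natural_filtration_def space_measure_of_conv)

lemma space_present_sigma [simp]: "space (present_sigma M X n) = space M"
  by (simp add: present_sigma_def)

lemma sets_natural_filtration:
  "sets (natural_filtration M X n) =
    sigma_sets (space M) {X i -` B \<inter> space M | i B. i \<le> n \<and> B \<in> sets borel}"
  unfolding natural_filtration_def by (rule sets_measure_of) auto

lemma sets_present_sigma:
  "sets (present_sigma M X n) = {X n -` B \<inter> space M | B. B \<in> sets borel}"
  unfolding present_sigma_def by (rule sets_vimage_algebra2) auto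

lemma measurable_present_sigma: "X n \<in> present_sigma M X n \<rightarrow>\<^sub>M borel"
  unfolding present_sigma_def by (rule measurable_vimage_algebra1) auto

lemma subalgebra_natural_filtration_mono:
  "m \<le> n \<Longrightarrow> subalgebra (natural_filtration M X n) (natural_filtration M X m)"
  unfolding subalgebra_def sets_natural_filtration
  by (auto intro!: sigma_sets_mono' intro: order_trans)

lemma subalgebra_present_sigma:
  "subalgebra (natural_filtration M X n) (present_sigma M X n)"
  unfolding subalgebra_def sets_natural_filtration sets_present_sigma by auto

section \<open>Recursion for decision times\<close>

text \<open>For every m > n the product starts at j = n, so \<open>1 - f n (X n \<omega>)\<close> is
  a common factor of all later summands and comes out of the sum. No subtraction is rearranged, so
  the identity holds for truncated subtraction and arbitrary natural values of
  \<open>f\<close>.\<close>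

lemma decision_time_rec:
  assumes "n \<le> N"
  shows "decision_time N X f n \<omega> =
    n * f n (X n \<omega>) + (1 - f n (X n \<omega>)) * decision_time N X f (Suc n) \<omega>"
proof -
  have "decision_time N X f n \<omega> = n * f n (X n \<omega>) +
      (\<Sum>m=Suc n..N. m * f m (X m \<omega>) * (\<Prod>j=n..<m. 1 - f j (X j \<omega>)))"
    using assms unfolding decision_time_def by (simp add: sum.atLeast_Suc_atMost)
  also have "(\<Sum>m=Suc n..N. m * f m (X m \<omega>) * (\<Prod>j=n..<m. 1 - f j (X j \<omega>))) =
      (\<Sum>m=Suc n..N. (1 - f n (X n \<omega>)) * (m * f m (X m \<omega>) * (\<Prod>j=Suc n..<m. 1 - f j (X j \<omega>))))"
    by (intro sum.cong) (auto simp: prod.atLeast_Suc_lessThan)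
  finally show ?thesis
    by (simp add: decision_time_def sum_distrib_left)
qed

text \<open>Allows \<open>f\<close> to be overwritten at index n without changing the decision time
  that starts at n + 1.\<close>

lemma decision_time_cong:
  assumes "\<And>k. n \<le> k \<Longrightarrow> f k = f' k"
  shows "decision_time N X f n = decision_time N X f' n"
  unfolding decision_time_def by (intro ext sum.cong refl arg_cong2[where f = "(*)"] prod.cong)
    (auto simp: assms)

section \<open>Closure properties of stopping times\<close>

lemma stopping_timesI:
  assumes "\<And>\<omega>. \<omega> \<in> space M \<Longrightarrow> n \<le> \<tau> \<omega> \<and> \<tau> \<omega> \<le> N"
    and "\<And>k. k \<le> N \<Longrightarrow> {\<omega> \<in> space M. \<tau> \<omega> = k} \<in> sets (natural_filtration M X k)"
  shows "\<tau> \<in> stopping_times M N X n"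
  using assms unfolding stopping_times_def by blast

lemma stopping_times_bounds:
  assumes "\<tau> \<in> stopping_times M N X n" "\<omega> \<in> space M"
  shows "n \<le> \<tau> \<omega>" "\<tau> \<omega> \<le> N"
  using assms unfolding stopping_times_def by blast+

lemma stopping_times_sets:
  assumes "\<tau> \<in> stopping_times M N X n" "k \<le> N"
  shows "{\<omega> \<in> space M. \<tau> \<omega> = k} \<in> sets (natural_filtration M X k)"
  using assms unfolding stopping_times_def by blast

text \<open>For k \<ge> n the event \<open>A\<close> also belongs to the past up to time k, so it
  may cut the level sets at k. For k < n there is nothing to cut, since neither time takes the value
  k.\<close>

lemma stopping_times_switch:
  assumes A: "A \<in> sets (natural_filtration M X n)"
    and \<sigma>: "\<sigma> \<in> stopping_times M N X n" and \<tau>: "\<tau> \<in> stopping_times M N X n"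
  shows "(\<lambda>\<omega>. if \<omega> \<in> A then \<sigma> \<omega> else \<tau> \<omega>) \<in> stopping_times M N X n"
proof (rule stopping_timesI)
  fix k assume "k \<le> N"
  let ?S = "{\<omega> \<in> space M. \<sigma> \<omega> = k}" and ?T = "{\<omega> \<in> space M. \<tau> \<omega> = k}"
  have eq: "{\<omega> \<in> space M. (if \<omega> \<in> A then \<sigma> \<omega> else \<tau> \<omega>) = k} = (?S \<inter> A) \<union> (?T - A)"
    by auto
  show "{\<omega> \<in> space M. (if \<omega> \<in> A then \<sigma> \<omega> else \<tau> \<omega>) = k} \<in> sets (natural_filtration M X k)"
  proof (cases "n \<le> k")
    case True
    have "A \<in> sets (natural_filtration M X k)"
      using A subalgebra_natural_filtration_mono[OF True] by (rule subalgebra_sets)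
    then show ?thesis
      unfolding eq
      by (intro sets.Un sets.Int sets.Diff stopping_times_sets[OF \<sigma> \<open>k \<le> N\<close>]
          stopping_times_sets[OF \<tau> \<open>k \<le> N\<close>])
  next
    case False
    then have "?S = {}" "?T = {}"
      using stopping_times_bounds(1)[OF \<sigma>] stopping_times_bounds(1)[OF \<tau>] by blast+
    then show ?thesis unfolding eq by (simp only:) simp
  qed
qed (simp add: stopping_times_bounds[OF \<sigma>] stopping_times_bounds[OF \<tau>])

lemma const_stopping_time:
  assumes "n \<le> N"
  shows "(\<lambda>_. n) \<in> stopping_times M N X n"
proof -
  have "{\<omega> \<in> space M. n = k} \<in> sets (natural_filtration M X k)" for k
    using sets.top[of "natural_filtration M X k"] by (cases "n = k") auto
  then show ?thesis
    using assms by (intro stopping_timesI conjI order_refl)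
qed

lemma stopping_times_antimono:
  assumes "m \<le> n"
  shows "stopping_times M N X n \<subseteq> stopping_times M N X m"
proof
  fix \<tau> assume \<tau>: "\<tau> \<in> stopping_times M N X n"
  have "m \<le> \<tau> \<omega> \<and> \<tau> \<omega> \<le> N" if "\<omega> \<in> space M" for \<omega>
    using stopping_times_bounds[OF \<tau> that] assms by simp
  then show "\<tau> \<in> stopping_times M N X m"
    by (intro stopping_timesI stopping_times_sets[OF \<tau>])
qed

text \<open>Transfers membership between times that are known to agree only on
  \<open>space M\<close>.\<close>

lemma stopping_times_cong:
  assumes "\<And>\<omega>. \<omega> \<in> space M \<Longrightarrow> \<sigma> \<omega> = \<tau> \<omega>" and \<tau>: "\<tau> \<in> stopping_times M N X n"
  shows "\<sigma> \<in> stopping_times M N X n"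
proof (rule stopping_timesI)
  fix k assume "k \<le> N"
  have "{\<omega> \<in> space M. \<sigma> \<omega> = k} = {\<omega> \<in> space M. \<tau> \<omega> = k}"
    using assms by auto
  with stopping_times_sets[OF \<tau> \<open>k \<le> N\<close>]
  show "{\<omega> \<in> space M. \<sigma> \<omega> = k} \<in> sets (natural_filtration M X k)" by simp
qed (simp add: assms stopping_times_bounds[OF \<tau>])

section \<open>Past and present as sub-sigma-algebras of the probability space\<close>

context discrete_markov_process
begin

lemma subalgebra_natural_filtration:
  assumes "n \<le> N"
  shows "subalgebra M (natural_filtration M X n)"
proof -
  have "X i -` B \<inter> space M \<in> sets M" if "i \<le> n" "B \<in> sets borel" for i B
    using measurable_sets[OF random_variable_X] that assms by auto
  then have "sigma_sets (space M) {X i -` B \<inter> space M | i B. i \<le> n \<and> B \<in> sets borel} \<subseteq> sets M"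
    by (intro sets.sigma_sets_subset) blast
  then show ?thesis
    by (simp add: subalgebra_def sets_natural_filtration)
qed

lemma subalgebra_present:
  assumes "n \<le> N"
  shows "subalgebra M (present_sigma M X n)"
  using subalgebra_natural_filtration[OF assms] subalgebra_present_sigma
  unfolding subalgebra_def by (metis subset_trans)

lemma sigma_finite_natural_filtration:
  assumes "n \<le> N"
  shows "sigma_finite_subalgebra M (natural_filtration M X n)"
  by (intro finite_measure_subalgebra_is_sigma_finite finite_measure_subalgebra.intro
      finite_measure_subalgebra_axioms.intro subalgebra_natural_filtration finite_measure_axioms assms)

lemma sigma_finite_present:
  assumes "n \<le> N"
  shows "sigma_finite_subalgebra M (present_sigma M X n)"
  by (intro finite_measure_subalgebra_is_sigma_finite finite_measure_subalgebra.intro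
      finite_measure_subalgebra_axioms.intro subalgebra_present finite_measure_axioms assms)

section \<open>The Markov property for integrable functions of the next state\<close>

text \<open>
  For a fixed event \<open>A\<close> of the past with conditional probability \<open>a\<close> given \<open>X n\<close>, the Markov property
  says that the densities \<open>indicator A\<close> and \<open>a\<close> define the same measure on the events of \<open>X (n + 1)\<close>.
  This carries it over from events to integrable functions without an approximation argument.
\<close>

lemma markov_property_integrable:
  assumes n: "n < N" and Y: "integrable M Y" "Y \<in> borel_measurable (present_sigma M X (Suc n))"
  shows "AE \<omega> in M. real_cond_exp M (natural_filtration M X n) Y \<omega> =
    real_cond_exp M (present_sigma M X n) Y \<omega>"
proof -
  interpret P: sigma_finite_subalgebra M "natural_filtration M X n"
    using n by (intro sigma_finite_natural_filtration) auto
  interpret Q: sigma_finite_subalgebra M "present_sigma M X n"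
    using n by (intro sigma_finite_present) auto
  let ?S = "present_sigma M X (Suc n)"
  have S: "subalgebra M ?S" using n by (intro subalgebra_present) auto
  show ?thesis
  proof (rule P.real_cond_exp_charact)
    fix A assume A: "A \<in> sets (natural_filtration M X n)"
    then have AM [measurable]: "A \<in> sets M"
      using P.subalg by (auto simp: subalgebra_def)
    define a where "a = real_cond_exp M (present_sigma M X n) (indicator A)"
    have a_meas [measurable]: "a \<in> borel_measurable M" "a \<in> borel_measurable (present_sigma M X n)"
      by (auto simp: a_def)
    have int_A: "integrable M (indicator A :: _ \<Rightarrow> real)"
      by (intro integrable_real_indicator) (auto simp: less_top[symmetric])
    have a_nonneg: "AE \<omega> in M. 0 \<le> a \<omega>"
      unfolding a_def by (intro Q.real_cond_exp_ge_c int_A) auto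
    \<comment> \<open>Conditioning on X n is self-adjoint: both sides equal the integral of
      \<open>a\<close> times the conditional expectation of \<open>Z\<close>, once because
      \<open>a\<close> is a function of X n and once because \<open>a\<close> is the conditional
      expectation of \<open>indicator A\<close>.\<close>
    have swap: "(\<integral>\<omega>. a \<omega> * Z \<omega> \<partial>M) =
        (\<integral>\<omega>. indicator A \<omega> * real_cond_exp M (present_sigma M X n) Z \<omega> \<partial>M)"
      if Z: "integrable M Z" "integrable M (\<lambda>\<omega>. a \<omega> * Z \<omega>)"
        "integrable M (\<lambda>\<omega>. real_cond_exp M (present_sigma M X n) Z \<omega> * indicator A \<omega>)" for Z
    proof -
      have "(\<integral>\<omega>. a \<omega> * Z \<omega> \<partial>M) = (\<integral>\<omega>. a \<omega> * real_cond_exp M (present_sigma M X n) Z \<omega> \<partial>M)"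
        using Z by (intro Q.real_cond_exp_intg(2)[symmetric]) auto
      also have "\<dots> = (\<integral>\<omega>. real_cond_exp M (present_sigma M X n) Z \<omega> * a \<omega> \<partial>M)"
        by (simp add: mult.commute)
      also have "\<dots> = (\<integral>\<omega>. real_cond_exp M (present_sigma M X n) Z \<omega> * indicator A \<omega> \<partial>M)"
        unfolding a_def using Z by (intro Q.real_cond_exp_intg(2)) auto
      finally show ?thesis by (simp add: mult.commute)
    qed
    have a_le: "AE \<omega> in M. a \<omega> \<le> 1"
      unfolding a_def by (intro Q.real_cond_exp_le_c int_A) auto
    have int_a: "integrable M (\<lambda>\<omega>. a \<omega> * Z \<omega>)" if "integrable M Z" for Z
    proof (rule Bochner_Integration.integrable_bound[OF that])
      show "AE \<omega> in M. norm (a \<omega> * Z \<omega>) \<le> norm (Z \<omega>)"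
        using a_nonneg a_le by eventually_elim (auto simp: abs_mult intro: mult_left_le_one_le)
    qed (use that in measurable)
    have int_AZ: "integrable M (\<lambda>\<omega>. real_cond_exp M (present_sigma M X n) Z \<omega> * indicator A \<omega>)"
      if "integrable M Z" for Z
      using integrable_mult_indicator[OF AM Q.real_cond_exp_int(1)[OF that]]
      by (simp add: mult.commute)

    \<comment> \<open>The restriction is essential: the two densities need not define the same
      measure on all of \<open>sets M\<close>, but they agree on events of X (n + 1), the only ones
      that \<open>markov_property\<close> speaks of.\<close>
    let ?\<mu> = "restr_to_subalg (density M (indicator A :: _ \<Rightarrow> real)) ?S"
    let ?\<nu> = "restr_to_subalg (density M a) ?S"
    have S_dens: "subalgebra (density M d) ?S" for d
      using S by (simp add: subalgebra_def)
    have "?\<mu> = ?\<nu>"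
    proof (rule measure_eqI)
      show "sets ?\<mu> = sets ?\<nu>" by (simp add: sets_restr_to_subalg[OF S_dens])
      fix C assume "C \<in> sets ?\<mu>"
      then have C: "C \<in> sets ?S" by (simp add: sets_restr_to_subalg[OF S_dens])
      then have CM [measurable]: "C \<in> sets M" using S by (auto simp: subalgebra_def)
      have int_C: "integrable M (indicator C :: _ \<Rightarrow> real)"
        by (intro integrable_real_indicator) (auto simp: less_top[symmetric])
      obtain B where B: "B \<in> sets borel" "C = X (Suc n) -` B \<inter> space M"
        using C by (auto simp: sets_present_sigma)
      have ind: "indicator C \<omega> = (indicator B (X (Suc n) \<omega>) :: real)" if "\<omega> \<in> space M" for \<omega>
        using that by (auto simp: B(2) indicator_def)
      have ind_meas: "(\<lambda>\<omega>. indicator B (X (Suc n) \<omega>) :: real) \<in> borel_measurable M"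
        by (subst measurable_cong[OF ind, symmetric]) auto
      \<comment> \<open>The locale assumption is stated for
        \<open>indicator B (X (Suc n) \<omega>)\<close>, which equals
        \<open>indicator C \<omega>\<close> only on \<open>space M\<close>; hence the passage
        through congruence of conditional expectations.\<close>
      have "AE \<omega> in M. real_cond_exp M (natural_filtration M X n) (indicator C) \<omega> =
          real_cond_exp M (present_sigma M X n) (indicator C) \<omega>"
        using markov_property[OF n B(1)]
          P.real_cond_exp_cong[of "indicator C", OF AE_I2[OF ind] _ ind_meas]
          Q.real_cond_exp_cong[of "indicator C", OF AE_I2[OF ind] _ ind_meas]
        by auto
      then have "(\<integral>\<omega>. indicator A \<omega> * real_cond_exp M (natural_filtration M X n) (indicator C) \<omega> \<partial>M) =
          (\<integral>\<omega>. indicator A \<omega> * real_cond_exp M (present_sigma M X n) (indicator C) \<omega> \<partial>M)"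
        by (intro integral_cong_AE) auto
      also have "\<dots> = (\<integral>\<omega>. a \<omega> * indicator C \<omega> \<partial>M)"
        by (intro swap[symmetric] int_C int_a int_AZ)
      finally have eq: "(\<integral>\<omega>. indicator A \<omega> * indicator C \<omega> \<partial>M) = (\<integral>\<omega>. a \<omega> * indicator C \<omega> \<partial>M)"
        using P.real_cond_exp_intg(2)[of "indicator A" "indicator C"] A CM
          integrable_mult_indicator[OF AM int_C]
        by simp
      \<comment> \<open>\<open>density\<close> sends negative values to 0, so the formula needs
        nonnegativity, which for \<open>a\<close> is known only almost everywhere.\<close>
      have dens: "emeasure (density M d) C = ennreal (\<integral>\<omega>. d \<omega> * indicator C \<omega> \<partial>M)"
        if "AE \<omega> in M. 0 \<le> d \<omega>" "integrable M (\<lambda>\<omega>. d \<omega> * indicator C \<omega>)"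
          "d \<in> borel_measurable M" for d :: "_ \<Rightarrow> real"
      proof -
        have "emeasure (density M d) C = (\<integral>\<^sup>+\<omega>. ennreal (d \<omega> * indicator C \<omega>) \<partial>M)"
          using that(3) by (subst emeasure_density) (auto intro!: nn_integral_cong split: split_indicator)
        also have "\<dots> = ennreal (\<integral>\<omega>. d \<omega> * indicator C \<omega> \<partial>M)"
          using that by (intro nn_integral_eq_integral) auto
        finally show ?thesis .
      qed
      show "emeasure ?\<mu> C = emeasure ?\<nu> C"
        using eq dens[OF a_nonneg int_a[OF int_C]] dens[of "indicator A"]
          integrable_mult_indicator[OF AM int_C]
        by (simp add: emeasure_restr_to_subalg[OF S_dens C])
    qed
    \<comment> \<open>Since \<open>Y\<close> is measurable with respect to \<open>?S\<close>, its
      integrals against the restricted measures are those against the densities.\<close>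
    then have "integral\<^sup>L ?\<mu> Y = integral\<^sup>L ?\<nu> Y" by simp
    then have "(\<integral>\<omega>. indicator A \<omega> * Y \<omega> \<partial>M) = (\<integral>\<omega>. a \<omega> * Y \<omega> \<partial>M)"
      using Y a_nonneg by (simp add: integral_subalgebra2[OF S_dens] integral_density)
    also have "\<dots> = (\<integral>\<omega>. indicator A \<omega> * real_cond_exp M (present_sigma M X n) Y \<omega> \<partial>M)"
      by (intro swap Y int_a int_AZ)
    finally show "(\<integral>\<omega>\<in>A. Y \<omega> \<partial>M) = (\<integral>\<omega>\<in>A. real_cond_exp M (present_sigma M X n) Y \<omega> \<partial>M)"
      by (simp add: set_lebesgue_integral_def)
  next
    show "real_cond_exp M (present_sigma M X n) Y \<in> borel_measurable (natural_filtration M X n)"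
      by (rule measurable_from_subalg[OF subalgebra_present_sigma]) simp
  qed (use Y Q.real_cond_exp_int(1) in auto)
qed

section \<open>Rewards at stopping times and at decision times\<close>

text \<open>The horizon is finite, so the stopped reward is a finite sum of the integrable rewards
  \<open>g k (X k \<omega>)\<close>, each cut off to the measurable event that \<tau> equals
  k.\<close>

lemma integrable_stopped_reward:
  assumes int: "\<And>k. k \<le> N \<Longrightarrow> integrable M (\<lambda>\<omega>. g k (X k \<omega>) :: real)"
    and \<tau>: "\<tau> \<in> stopping_times M N X n"
  shows "integrable M (\<lambda>\<omega>. g (\<tau> \<omega>) (X (\<tau> \<omega>) \<omega>))"
proof -
  have "{\<omega> \<in> space M. \<tau> \<omega> = k} \<in> sets M" if "k \<le> N" for k
    using stopping_times_sets[OF \<tau> that] subalgebra_natural_filtration[OF that]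
    unfolding subalgebra_def by blast
  then have "integrable M (\<lambda>\<omega>. \<Sum>k\<le>N. indicator {\<omega> \<in> space M. \<tau> \<omega> = k} \<omega> *\<^sub>R g k (X k \<omega>))"
    by (intro Bochner_Integration.integrable_sum integrable_mult_indicator int) auto
  moreover have "(\<Sum>k\<le>N. indicator {\<omega> \<in> space M. \<tau> \<omega> = k} \<omega> *\<^sub>R g k (X k \<omega>)) =
      g (\<tau> \<omega>) (X (\<tau> \<omega>) \<omega>)" if "\<omega> \<in> space M" for \<omega>
  proof -
    have "(\<Sum>k\<le>N. indicator {\<omega> \<in> space M. \<tau> \<omega> = k} \<omega> *\<^sub>R g k (X k \<omega>)) =
        (\<Sum>k\<le>N. if \<tau> \<omega> = k then g k (X k \<omega>) else 0)"
      using that by (intro sum.cong) (auto simp: indicator_def)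
    then show ?thesis
      using stopping_times_bounds[OF \<tau> that] by simp
  qed
  ultimately show ?thesis
    by (simp cong: Bochner_Integration.integrable_cong)
qed

text \<open>Backward induction on the starting time. Conditioning on the past up to n + 1 turns the
  later reward into a function of X (n + 1), and the Markov property turns that into a function of X
  n. The decision at n and the reward for stopping there are functions of X n already.\<close>

lemma decision_reward_markov:
  assumes g_meas: "\<And>k. k \<le> N \<Longrightarrow> g k \<in> borel_measurable borel"
    and int: "\<And>k. k \<le> N \<Longrightarrow> integrable M (\<lambda>\<omega>. g k (X k \<omega>) :: real)"
    and f_meas: "\<And>k. n \<le> k \<Longrightarrow> k \<le> N \<Longrightarrow> f k \<in> borel \<rightarrow>\<^sub>M count_space {0, 1}"
    and f_N: "\<And>x. f N x = 1"
    and "n \<le> N"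
  defines "R \<equiv> \<lambda>k \<omega>. g (decision_time N X f k \<omega>) (X (decision_time N X f k \<omega>) \<omega>)"
  shows "integrable M (R n) \<and> (\<exists>Y \<in> borel_measurable (present_sigma M X n).
    AE \<omega> in M. real_cond_exp M (natural_filtration M X n) (R n) \<omega> = Y \<omega>)"
  using \<open>n \<le> N\<close> f_meas
proof (induction n rule: inc_induct)
  case base
  have R: "R N = (\<lambda>\<omega>. g N (X N \<omega>))"
    by (simp add: R_def decision_time_def f_N)
  interpret P: sigma_finite_subalgebra M "natural_filtration M X N"
    by (intro sigma_finite_natural_filtration) auto
  have meas: "(\<lambda>\<omega>. g N (X N \<omega>)) \<in> borel_measurable (present_sigma M X N)"
    by (rule measurable_compose[OF measurable_present_sigma g_meas]) simp
  then have "AE \<omega> in M. real_cond_exp M (natural_filtration M X N) (R N) \<omega> = g N (X N \<omega>)"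
    unfolding R using int[of N]
    by (intro P.real_cond_exp_F_meas measurable_from_subalg[OF subalgebra_present_sigma]) auto
  then show ?case
    using meas int[of N] R by auto
next
  case (step n)
  interpret P: sigma_finite_subalgebra M "natural_filtration M X n"
    using step by (intro sigma_finite_natural_filtration) auto
  interpret P': sigma_finite_subalgebra M "natural_filtration M X (Suc n)"
    using step by (intro sigma_finite_natural_filtration) auto
  obtain Y where R': "integrable M (R (Suc n))" and Y [measurable]: "Y \<in> borel_measurable (present_sigma M X (Suc n))"
    and Y_eq: "AE \<omega> in M. real_cond_exp M (natural_filtration M X (Suc n)) (R (Suc n)) \<omega> = Y \<omega>"
    using step.IH step.prems by auto
  have Y_M [measurable]: "Y \<in> borel_measurable M"
    using step by (intro measurable_from_subalg[OF subalgebra_present Y]) auto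
  have Y_int: "integrable M Y"
    using integrable_cong_AE_imp[OF P'.real_cond_exp_int(1)[OF R'] Y_M] Y_eq by auto
  \<comment> \<open>Tower property: condition on the past up to n + 1 first, which gives
    \<open>Y\<close>, then apply the Markov property to \<open>Y\<close>.\<close>
  have cond: "AE \<omega> in M. real_cond_exp M (natural_filtration M X n) (R (Suc n)) \<omega> =
      real_cond_exp M (present_sigma M X n) Y \<omega>"
  proof -
    have "AE \<omega> in M. real_cond_exp M (natural_filtration M X n)
        (real_cond_exp M (natural_filtration M X (Suc n)) (R (Suc n))) \<omega> =
        real_cond_exp M (natural_filtration M X n) Y \<omega>"
      using Y_eq by (intro P.real_cond_exp_cong) auto
    then show ?thesis
      using markov_property_integrable[OF step.hyps(2) Y_int Y]
        P.real_cond_exp_nested_subalg[OF P'.subalg subalgebra_natural_filtration_mono R']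
      by auto
  qed
  define b where "b \<omega> = real (f n (X n \<omega>))" for \<omega>
  have f_n: "f n \<in> borel \<rightarrow>\<^sub>M count_space {0, 1}"
    using step by auto
  have "f n x \<in> {0, 1}" for x
    using measurable_space[OF f_n, of x] by auto
  then have b01: "b \<omega> = 0 \<or> b \<omega> = 1" for \<omega>
    by (auto simp: b_def)
  have b [measurable]: "b \<in> borel_measurable (present_sigma M X n)"
  proof -
    have "(\<lambda>x. real (f n x)) \<in> borel_measurable borel"
      by (rule measurable_compose[OF f_n]) simp
    then show ?thesis
      unfolding b_def by (rule measurable_compose[OF measurable_present_sigma])
  qed
  have gX [measurable]: "(\<lambda>\<omega>. g n (X n \<omega>)) \<in> borel_measurable (present_sigma M X n)"
    using step by (intro measurable_compose[OF measurable_present_sigma g_meas]) simp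
  have bN: "b \<in> borel_measurable (natural_filtration M X n)"
    "(\<lambda>\<omega>. g n (X n \<omega>)) \<in> borel_measurable (natural_filtration M X n)"
    by (auto intro: measurable_from_subalg[OF subalgebra_present_sigma])
  have bM [measurable]: "b \<in> borel_measurable M"
    using measurable_from_subalg[OF P.subalg] bN by auto
  have int_b: "integrable M (\<lambda>\<omega>. b \<omega> * Z \<omega>)" "integrable M (\<lambda>\<omega>. (1 - b \<omega>) * Z \<omega>)"
    if Z: "integrable M Z" for Z
  proof -
    have [measurable]: "Z \<in> borel_measurable M" using Z by auto
    have "norm (b \<omega> * Z \<omega>) \<le> norm (Z \<omega>)" "norm ((1 - b \<omega>) * Z \<omega>) \<le> norm (Z \<omega>)" for \<omega>
      using b01[of \<omega>] by auto
    then show "integrable M (\<lambda>\<omega>. b \<omega> * Z \<omega>)" "integrable M (\<lambda>\<omega>. (1 - b \<omega>) * Z \<omega>)"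
      by (auto intro!: Bochner_Integration.integrable_bound[OF Z])
  qed
  have int_n: "integrable M (\<lambda>\<omega>. g n (X n \<omega>))" using int step by auto
  \<comment> \<open>As \<open>b\<close> is 0 or 1, this combination selects one of two rewards. It
    is linear in them with coefficients measurable at time n, so conditioning acts on each summand
    separately.\<close>
  have R_eq: "R n = (\<lambda>\<omega>. b \<omega> * g n (X n \<omega>) + (1 - b \<omega>) * R (Suc n) \<omega>)"
  proof
    fix \<omega>
    show "R n \<omega> = b \<omega> * g n (X n \<omega>) + (1 - b \<omega>) * R (Suc n) \<omega>"
      using b01[of \<omega>] step.hyps unfolding R_def b_def
      by (auto simp: decision_time_rec[of n N])
  qed
  have "AE \<omega> in M. real_cond_exp M (natural_filtration M X n) (R n) \<omega> =
      b \<omega> * g n (X n \<omega>) + (1 - b \<omega>) * real_cond_exp M (present_sigma M X n) Y \<omega>"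
  proof -
    have "AE \<omega> in M. real_cond_exp M (natural_filtration M X n) (\<lambda>\<omega>. b \<omega> * g n (X n \<omega>)) \<omega> =
        b \<omega> * g n (X n \<omega>)"
      using bN by (intro P.real_cond_exp_F_meas int_b int_n) auto
    moreover have "AE \<omega> in M. real_cond_exp M (natural_filtration M X n)
        (\<lambda>\<omega>. (1 - b \<omega>) * R (Suc n) \<omega>) \<omega> =
        (1 - b \<omega>) * real_cond_exp M (natural_filtration M X n) (R (Suc n)) \<omega>"
      using bN R' by (intro P.real_cond_exp_mult int_b) auto
    ultimately show ?thesis
      using cond P.real_cond_exp_add[OF int_b(1)[OF int_n] int_b(2)[OF R']]
      unfolding R_eq by auto
  qed
  moreover have "(\<lambda>\<omega>. b \<omega> * g n (X n \<omega>) + (1 - b \<omega>) * real_cond_exp M (present_sigma M X n) Y \<omega>)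
      \<in> borel_measurable (present_sigma M X n)"
    by measurable
  moreover have "integrable M (R n)"
    unfolding R_eq by (intro Bochner_Integration.integrable_add int_b int_n R')
  ultimately show ?case by (intro conjI bexI)
qed

end

theorem theorem1:
  fixes M :: "'w measure"
    and N n :: nat
    and X :: "nat \<Rightarrow> 'w \<Rightarrow> real ^ 'd"
    and g :: "nat \<Rightarrow> real ^ 'd \<Rightarrow> real"
    and f :: "nat \<Rightarrow> real ^ 'd \<Rightarrow> nat"
    and \<tau> :: "'w \<Rightarrow> nat"
  assumes markov: "discrete_markov_process M N X"
    and g_measurable: "(\<lambda>(k, x). g k x) \<in> borel_measurable (count_space {0..N} \<Otimes>\<^sub>M borel)"
    and g_integrable: "\<And>k. k \<le> N \<Longrightarrow> integrable M (\<lambda>\<omega>. g k (X k \<omega>))"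
    and n_less: "n < N"
    and f_measurable: "\<And>k. n + 1 \<le> k \<Longrightarrow> k \<le> N \<Longrightarrow> f k \<in> borel \<rightarrow>\<^sub>M count_space {0, 1}"
    and f_N: "\<And>x. f N x = 1"
    and \<tau>_stopping: "\<tau> \<in> stopping_times M N X (n + 1)"
    and \<tau>_form: "\<And>\<omega>. \<omega> \<in> space M \<Longrightarrow> \<tau> \<omega> = decision_time N X f (n + 1) \<omega>"
  shows "\<exists>h. h \<in> borel \<rightarrow>\<^sub>M count_space {0, 1} \<and>
           decision_time N X (f(n := h)) n \<in> stopping_times M N X n \<and>
           expected_reward M X g (decision_time N X (f(n := h)) n) \<ge>
             optimal_value M N X g n -
               (optimal_value M N X g (n + 1) - expected_reward M X g \<tau>)"
proof -
  interpret discrete_markov_process M N X by (rule markov)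
  have g_meas: "g k \<in> borel_measurable borel" if "k \<le> N" for k
  proof -
    have "(\<lambda>x. (k, x)) \<in> borel \<rightarrow>\<^sub>M count_space {0..N} \<Otimes>\<^sub>M borel"
      using that by (intro measurable_Pair) auto
    from measurable_compose[OF this g_measurable] show ?thesis by simp
  qed
  interpret P: sigma_finite_subalgebra M "natural_filtration M X n"
    using n_less by (intro sigma_finite_natural_filtration) auto
  interpret P': sigma_finite_subalgebra M "natural_filtration M X (Suc n)"
    using n_less by (intro sigma_finite_natural_filtration) auto
  let ?rew = "\<lambda>\<sigma> \<omega>. g (\<sigma> \<omega>) (X (\<sigma> \<omega>) \<omega>)"
  let ?R = "?rew \<tau>"
  have int_R: "integrable M ?R"
    by (rule integrable_stopped_reward[where g = g, OF g_integrable \<tau>_stopping])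
  have int_g: "integrable M (\<lambda>\<omega>. g n (X n \<omega>))" using g_integrable n_less by auto

  obtain Y where Y: "Y \<in> borel_measurable (present_sigma M X n)" "integrable M Y"
    and Y_eq: "AE \<omega> in M. real_cond_exp M (natural_filtration M X n) ?R \<omega> = Y \<omega>"
  proof -
    \<comment> \<open>With \<open>h = 0\<close>, the decision time started at \<open>n\<close> is the one started at \<open>n + 1\<close>.\<close>
    let ?f = "f(n := (\<lambda>_. 0))"
    have f0: "?f k \<in> borel \<rightarrow>\<^sub>M count_space {0, 1}" if "n \<le> k" "k \<le> N" for k
      using f_measurable[of k] that by (cases "k = n") auto
    have eq: "decision_time N X ?f n \<omega> = \<tau> \<omega>" if "\<omega> \<in> space M" for \<omega>
      using n_less \<tau>_form[OF that] decision_time_cong[of "Suc n" ?f f N X]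
      by (simp add: decision_time_rec[of n N])
    let ?R' = "?rew (decision_time N X ?f n)"
    \<comment> \<open>Overwriting index n keeps the last decision equal to 1 because n < N.\<close>
    obtain Y where R': "integrable M ?R'"
      and Y: "Y \<in> borel_measurable (present_sigma M X n)"
      and Y_eq: "AE \<omega> in M. real_cond_exp M (natural_filtration M X n) ?R' \<omega> = Y \<omega>"
      using decision_reward_markov[where g = g and f = ?f and n = n, OF g_meas g_integrable f0]
        n_less f_N
      by auto
    have "AE \<omega> in M. real_cond_exp M (natural_filtration M X n) ?R \<omega> =
        real_cond_exp M (natural_filtration M X n) ?R' \<omega>"
      using int_R R' by (intro P.real_cond_exp_cong) (auto simp: eq)
    then have Y_eq': "AE \<omega> in M. real_cond_exp M (natural_filtration M X n) ?R \<omega> = Y \<omega>"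
      using Y_eq by auto
    have "Y \<in> borel_measurable M"
      using n_less by (intro measurable_from_subalg[OF subalgebra_present Y]) auto
    then have "integrable M Y"
      by (rule integrable_cong_AE_imp[OF P.real_cond_exp_int(1)[OF int_R]]) (use Y_eq' in auto)
    with Y Y_eq' show ?thesis using that by blast
  qed

  \<comment> \<open>One family contains both the rule to be constructed (\<open>A\<close> =
    \<open>D\<close>) and the rules it is compared with, so all their rewards reduce to integrals of
    \<open>g n (X n \<omega>)\<close> and \<open>Y\<close>.\<close>
  let ?switch = "\<lambda>A \<omega>. if \<omega> \<in> A then n else \<tau> \<omega>"
  have switch: "?switch A \<in> stopping_times M N X n"
    "expected_reward M X g (?switch A) = (\<integral>\<omega>. (if \<omega> \<in> A then g n (X n \<omega>) else Y \<omega>) \<partial>M)"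
    "integrable M (\<lambda>\<omega>. if \<omega> \<in> A then g n (X n \<omega>) else Y \<omega>)"
    if A: "A \<in> sets (natural_filtration M X n)" for A
  proof -
    have AM: "A \<in> sets M" using A P.subalg by (auto simp: subalgebra_def)
    then have AM': "space M - A \<in> sets M" by auto
    show "?switch A \<in> stopping_times M N X n"
      using n_less \<tau>_stopping stopping_times_antimono[of n "n + 1" M N X]
      by (intro stopping_times_switch A const_stopping_time) auto
    have if_eq: "(if \<omega> \<in> A then u \<omega> else v \<omega>) = indicator A \<omega> * u \<omega> + indicator (space M - A) \<omega> * v \<omega>"
      if "\<omega> \<in> space M" for \<omega> and u v :: "'w \<Rightarrow> real"
      using that by auto
    have ind: "integrable M (\<lambda>\<omega>. indicator A \<omega> * u \<omega>)"
      "integrable M (\<lambda>\<omega>. indicator (space M - A) \<omega> * u \<omega>)" if "integrable M u" for u :: "'w \<Rightarrow> real"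
      using integrable_mult_indicator[OF AM that] integrable_mult_indicator[OF AM' that] by auto
    have int_if: "(\<integral>\<omega>. (if \<omega> \<in> A then u \<omega> else v \<omega>) \<partial>M) =
        (\<integral>\<omega>. indicator A \<omega> * u \<omega> \<partial>M) + (\<integral>\<omega>. indicator (space M - A) \<omega> * v \<omega> \<partial>M)"
      if "integrable M u" "integrable M v" for u v :: "'w \<Rightarrow> real"
      by (subst Bochner_Integration.integral_cong[OF refl if_eq], assumption)
        (intro Bochner_Integration.integral_add ind that)
    show "integrable M (\<lambda>\<omega>. if \<omega> \<in> A then g n (X n \<omega>) else Y \<omega>)"
      by (subst Bochner_Integration.integrable_cong[OF refl if_eq], assumption)
        (intro Bochner_Integration.integrable_add ind int_g Y)
    \<comment> \<open>The complement of \<open>A\<close> is an event of the past, so on it the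
      reward of \<tau> may be replaced by its conditional expectation \<open>Y\<close> under the
      integral.\<close>
    have "space M - A \<in> sets (natural_filtration M X n)"
      using sets.compl_sets[OF A] by simp
    from P.real_cond_exp_intA[OF int_R this]
    have "(\<integral>\<omega>. indicator (space M - A) \<omega> * ?R \<omega> \<partial>M) = (\<integral>\<omega>. indicator (space M - A) \<omega> *
        real_cond_exp M (natural_filtration M X n) ?R \<omega> \<partial>M)"
      by (simp add: set_lebesgue_integral_def)
    also have "\<dots> = (\<integral>\<omega>. indicator (space M - A) \<omega> * Y \<omega> \<partial>M)"
      using Y_eq ind(2)[OF Y(2)] AM' by (intro integral_cong_AE) auto
    finally have eq: "(\<integral>\<omega>. indicator (space M - A) \<omega> * ?R \<omega> \<partial>M) =
        (\<integral>\<omega>. indicator (space M - A) \<omega> * Y \<omega> \<partial>M)" .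
    have "expected_reward M X g (?switch A) = (\<integral>\<omega>. (if \<omega> \<in> A then g n (X n \<omega>) else ?R \<omega>) \<partial>M)"
      unfolding expected_reward_def by (intro Bochner_Integration.integral_cong) auto
    then show "expected_reward M X g (?switch A) =
        (\<integral>\<omega>. (if \<omega> \<in> A then g n (X n \<omega>) else Y \<omega>) \<partial>M)"
      by (simp only: int_if[OF int_g int_R] int_if[OF int_g Y(2)] eq)
  qed

  \<comment> \<open>With this choice the integrand of the switched reward is the pointwise maximum
    of \<open>g n (X n \<omega>)\<close> and \<open>Y\<close>.\<close>
  define D where "D = {\<omega> \<in> space M. Y \<omega> \<le> g n (X n \<omega>)}"
  have D: "D \<in> sets (present_sigma M X n)"
  proof -
    have "(\<lambda>\<omega>. g n (X n \<omega>)) \<in> borel_measurable (present_sigma M X n)"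
      using n_less by (intro measurable_compose[OF measurable_present_sigma g_meas]) simp
    then have "{\<omega> \<in> space (present_sigma M X n). Y \<omega> \<le> g n (X n \<omega>)} \<in> sets (present_sigma M X n)"
      using Y(1) by measurable
    then show ?thesis by (simp add: D_def)
  qed
  \<comment> \<open>Here it matters that \<open>Y\<close> depends on X n alone: \<open>D\<close> is
    then an event of the present state, so the decision can be read off from X n.\<close>
  then obtain B where B: "B \<in> sets borel" "D = X n -` B \<inter> space M"
    by (auto simp: sets_present_sigma)
  have DF: "D \<in> sets (natural_filtration M X n)"
    using D subalgebra_present_sigma by (auto simp: subalgebra_def)
  define h :: "real ^ 'd \<Rightarrow> nat" where "h x = (if x \<in> B then 1 else 0)" for x
  have h: "h \<in> borel \<rightarrow>\<^sub>M count_space {0, 1}"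
    unfolding h_def using B(1) by measurable
  \<comment> \<open>On \<open>D\<close> the decision 1 yields n. Off \<open>D\<close> the decision 0
    passes on to the decision time from n + 1, where \<open>f(n := h)\<close> agrees with
    \<open>f\<close>.\<close>
  have dec: "decision_time N X (f(n := h)) n \<omega> = ?switch D \<omega>" if "\<omega> \<in> space M" for \<omega>
    using n_less \<tau>_form[OF that] decision_time_cong[of "Suc n" "f(n := h)" f N X] that
    by (auto simp: decision_time_rec[of n N] B(2) h_def)
  have reward_dec: "expected_reward M X g (decision_time N X (f(n := h)) n) =
      expected_reward M X g (?switch D)"
    unfolding expected_reward_def by (intro Bochner_Integration.integral_cong) (auto simp: dec)

  have "optimal_value M N X g n \<le>
      expected_reward M X g (?switch D) + (optimal_value M N X g (n + 1) - expected_reward M X g \<tau>)"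
    unfolding optimal_value_def[of _ _ _ _ n]
  proof (rule cSUP_least)
    show "stopping_times M N X n \<noteq> {}" using n_less by (intro stopping_times_nonempty) auto
    fix \<rho> assume \<rho>: "\<rho> \<in> stopping_times M N X n"
    define A where "A = {\<omega> \<in> space M. \<rho> \<omega> = n}"
    have A: "A \<in> sets (natural_filtration M X n)"
      unfolding A_def using stopping_times_sets[OF \<rho>] n_less by auto
    \<comment> \<open>Replacing \<rho> by \<tau> exactly where \<rho> stops at n raises the lower
      bound to n + 1, so the reward of \<sigma> is at most the optimal value at n + 1.\<close>
    define \<sigma> where "\<sigma> \<omega> = (if \<omega> \<in> A then \<tau> \<omega> else \<rho> \<omega>)" for \<omega>
    have \<sigma>_n: "\<sigma> \<in> stopping_times M N X n"
      unfolding \<sigma>_def using \<tau>_stopping stopping_times_antimono[of n "n + 1" M N X]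
      by (intro stopping_times_switch A \<rho>) auto
    have \<sigma>_gt: "n + 1 \<le> \<sigma> \<omega>" if "\<omega> \<in> space M" for \<omega>
      using stopping_times_bounds(1)[OF \<rho> that] stopping_times_bounds(1)[OF \<tau>_stopping that] that
      by (auto simp: \<sigma>_def A_def)
    have \<sigma>: "\<sigma> \<in> stopping_times M N X (n + 1)"
      by (intro stopping_timesI conjI \<sigma>_gt stopping_times_bounds(2)[OF \<sigma>_n] stopping_times_sets[OF \<sigma>_n])
    then have le_V: "expected_reward M X g \<sigma> \<le> optimal_value M N X g (n + 1)"
      unfolding optimal_value_def by (intro cSUP_upper bdd_above_expected_reward g_integrable)
    \<comment> \<open>On \<open>A\<close> the pair \<open>(\<rho>, \<tau>)\<close> equals \<open>(n, \<sigma>)\<close>, off \<open>A\<close> it equals \<open>(\<sigma>, \<tau>)\<close>.\<close>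
    have "(\<integral>\<omega>. ?rew \<rho> \<omega> + ?R \<omega> \<partial>M) = (\<integral>\<omega>. ?rew (?switch A) \<omega> + ?rew \<sigma> \<omega> \<partial>M)"
      by (intro Bochner_Integration.integral_cong) (auto simp: \<sigma>_def A_def)
    then have "expected_reward M X g \<rho> + expected_reward M X g \<tau> =
        expected_reward M X g (?switch A) + expected_reward M X g \<sigma>"
      using integrable_stopped_reward[where g = g, OF g_integrable \<rho>] int_R
        integrable_stopped_reward[where g = g, OF g_integrable \<sigma>]
        integrable_stopped_reward[where g = g, OF g_integrable switch(1)[OF A]]
      unfolding expected_reward_def by simp
    \<comment> \<open>On \<open>D\<close> the first alternative is the larger one and off
      \<open>D\<close> the second, so the integrand for \<open>D\<close> dominates the one for
      \<open>A\<close> pointwise.\<close>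
    moreover have "expected_reward M X g (?switch A) \<le> expected_reward M X g (?switch D)"
      unfolding switch(2)[OF A] switch(2)[OF DF]
      by (intro integral_mono switch(3) A DF) (auto simp: D_def)
    ultimately show "expected_reward M X g \<rho> \<le> expected_reward M X g (?switch D) +
        (optimal_value M N X g (n + 1) - expected_reward M X g \<tau>)"
      using le_V by linarith
  qed
  then have "expected_reward M X g (decision_time N X (f(n := h)) n) \<ge>
      optimal_value M N X g n - (optimal_value M N X g (n + 1) - expected_reward M X g \<tau>)"
    unfolding reward_dec by linarith
  moreover have "decision_time N X (f(n := h)) n \<in> stopping_times M N X n"
    by (rule stopping_times_cong[OF dec switch(1)[OF DF]])
  ultimately show ?thesis using h by blast
qed

end
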